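(* Let $H$ be a Hilbert space and $\mathbb{D}\subset H$ a symmetric dictionary (i.e. $g\in\mathbb{D}$ implies $-g\in\mathbb{D}$) with $\sup_{d\in\mathbb{D}}\|d\|_H\le C<\infty$. Let $\mathcal{L}:H\to\mathbb{R}$ be convex and $K$-smooth, and let $M>0$. Let the iterates $u_n$ be given by the relaxed greedy algorithm $$u_0=0,\qquad g_n=\arg\max_{g\in\mathbb{D}}\langle g,\nabla\mathcal{L}(u_{n-1})\rangle_H,\qquad u_n=(1-\alpha_n)u_{n-1}-M\alpha_n g_n,\qquad \alpha_n=\min\left(1,\tfrac{2}{n}\right),\quad n\ge 1.$$ Then for every $n\ge 1$ we have $u_n\in\Sigma_{n,M}(\mathbb{D})$ and $$\mathcal{L}(u_n)-\inf_{\|v\|_{\mathcal{K}_1(\mathbb{D})}\le M}\mathcal{L}(v)\le\frac{32(CM)^2K}{n}.$$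
   Context: $K$-smoothness of the (differentiable) function $\mathcal{L}$ means that for all $u,v\in H$, $\mathcal{L}(u)\le\mathcal{L}(v)+\langle\nabla\mathcal{L}(v),u-v\rangle_H+\frac{K}{2}\|u-v\|_H^2$. $\Sigma_{n,M}(\mathbb{D})=\{\sum_{i=1}^n a_id_i:\ d_i\in\mathbb{D},\ \sum_{i=1}^n|a_i|\le M\}$ (real coefficients $a_i$). $B_1(\mathbb{D})=\overline{\bigcup_{n\ge1}\Sigma_{n,1}(\mathbb{D})}$, closure in $H$, and $\|f\|_{\mathcal{K}_1(\mathbb{D})}=\inf\{c>0: f\in cB_1(\mathbb{D})\}$. The maximizers $g_n$ are assumed to exist (any maximizer may be chosen). *)

theory Defs
  imports "HOL-Analysis.Analysis"
begin

definition symmetric_dictionary :: "'a::real_vector set \<Rightarrow> bool" where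
  "symmetric_dictionary D \<longleftrightarrow> (\<forall>g\<in>D. - g \<in> D)"

definition gradient :: "('a::real_inner \<Rightarrow> real) \<Rightarrow> 'a \<Rightarrow> 'a" where
  "gradient f x = (THE D. GDERIV f x :> D)"

text \<open>On a Hilbert space the first conjunct is Frechet differentiability, by the Riesz
  representation theorem.\<close>

definition K_smooth :: "real \<Rightarrow> ('a::real_inner \<Rightarrow> real) \<Rightarrow> bool" where
  "K_smooth K f \<longleftrightarrow>
     (\<forall>v. \<exists>D. GDERIV f v :> D) \<and>
     (\<forall>u v. f u \<le> f v + inner (gradient f v) (u - v) + K / 2 * (norm (u - v))\<^sup>2)"

definition Sigma_dict :: "nat \<Rightarrow> real \<Rightarrow> 'a::real_vector set \<Rightarrow> 'a set" where
  "Sigma_dict n M D =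
     {v. \<exists>a d. (\<forall>i\<in>{1..n}. d i \<in> D) \<and> (\<Sum>i=1..n. \<bar>a i\<bar>) \<le> M \<and>
               v = (\<Sum>i=1..n. a i *\<^sub>R d i)}"

definition B1 :: "'a::real_normed_vector set \<Rightarrow> 'a set" where
  "B1 D = closure (\<Union>n\<in>{1..}. Sigma_dict n 1 D)"

text \<open>The gauge of \<open>B1 D\<close> is extended-real valued, so that it is \<open>\<infinity>\<close> at points lying in no
  multiple of \<open>B1 D\<close> (infimum of the empty set).\<close>

definition K1_norm :: "'a::real_normed_vector set \<Rightarrow> 'a \<Rightarrow> ereal" where
  "K1_norm D f = (INF c\<in>{c::real. c > 0 \<and> f \<in> (*\<^sub>R) c ` B1 D}. ereal c)"

definition relaxed_step :: "nat \<Rightarrow> real" where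
  "relaxed_step n = min 1 (2 / real n)"

text \<open>The maximizers need be neither unique nor given by a selection rule, so the algorithm
  is a relation: \<open>u\<close> and \<open>g\<close> are admissible sequences of iterates and maximizers. The value
  \<open>g 0\<close> is irrelevant.\<close>

definition relaxed_greedy ::
    "'a::real_inner set \<Rightarrow> ('a \<Rightarrow> real) \<Rightarrow> real \<Rightarrow> (nat \<Rightarrow> 'a) \<Rightarrow> (nat \<Rightarrow> 'a) \<Rightarrow> bool" where
  "relaxed_greedy D L M u g \<longleftrightarrow>
     u 0 = 0 \<and>
     (\<forall>n\<ge>1. is_arg_max (\<lambda>h. inner h (gradient L (u (n - 1)))) (\<lambda>h. h \<in> D) (g n) \<and>
             u n = (1 - relaxed_step n) *\<^sub>R u (n - 1) - (M * relaxed_step n) *\<^sub>R g n)"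

end

theory Submission
  imports Defs
begin

text \<open>
  The relaxed greedy algorithm is a Frank--Wolfe method on the ball of radius \<open>M\<close> of the
  gauge \<open>K1_norm D\<close>, which is the closed convex hull of \<open>M D\<close>. A linear functional is bounded
  below on this ball by its infimum over \<open>M D\<close>, and by symmetry of the dictionary the
  functional given by the gradient \<open>p\<close> of \<open>L\<close> at \<open>u (n - 1)\<close> attains that infimum at
  \<open>- M g n\<close>, where \<open>g n\<close> is the greedy choice (lemma \<open>K1_ball_inner_ge\<close>). Hence, for every
  competitor \<open>v\<close> in the ball, the tangent inequality of the convex function \<open>L\<close> (lemma
  \<open>convex_on_gradient_le\<close>) gives

  \<open>\<langle>p, - M g n - u (n - 1)\<rangle> \<le> \<langle>p, v - u (n - 1)\<rangle> \<le> L v - L (u (n - 1))\<close>.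

  Each iterate is a combination of dictionary elements with coefficients of absolute sum at
  most \<open>M\<close>, because a step replaces \<open>u (n - 1)\<close> by a convex combination of it with
  \<open>- M g n\<close>; so \<open>u (n - 1) + M g n\<close> has norm at most \<open>2 C M\<close>. Inserting both bounds into the
  smoothness inequality for the step \<open>u n - u (n - 1) = - \<alpha> (u (n - 1) + M g n)\<close>, where \<open>\<alpha>\<close> is
  the \<open>n\<close>-th step size, yields the recursion

  \<open>e n \<le> (1 - \<alpha>) e (n - 1) + 2 K (C M)\<^sup>2 \<alpha>\<^sup>2\<close> for \<open>e n = L (u n) - L v\<close>,

  and step sizes \<open>min 1 (2 / n)\<close> turn it into \<open>e n \<le> 8 K (C M)\<^sup>2 / n\<close> (lemma
  \<open>relaxed_recursion_bound\<close>). As \<open>v\<close> is arbitrary, the same bound holds against the infimum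
  over the ball, and \<open>8 \<le> 32\<close>.
\<close>

lemma GDERIV_gradient:
  assumes "\<exists>D. GDERIV f x :> D"
  shows "GDERIV f x :> gradient f x"
proof -
  obtain D where D: "GDERIV f x :> D"
    using assms by blast
  have "E = D" if "GDERIV f x :> E" for E
  proof -
    have "(\<lambda>h. inner h E) = (\<lambda>h. inner h D)"
      using that D unfolding gderiv_def by (rule has_derivative_unique)
    then have "inner (E - D) E = inner (E - D) D"
      by (rule fun_cong)
    then have "inner (E - D) (E - D) = 0"
      by (simp only: inner_diff_right diff_self)
    then show ?thesis
      by simp
  qed
  with D show ?thesis
    unfolding gradient_def by (metis theI)
qed

text \<open>The one-dimensional tangent inequality, applied to the restriction of \<open>f\<close> to the line
  through \<open>x\<close> and \<open>y\<close>.\<close>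

lemma convex_on_gradient_le:
  fixes f :: "'a::real_inner \<Rightarrow> real"
  assumes "convex_on UNIV f" and "GDERIV f x :> D"
  shows "inner D (y - x) \<le> f y - f x"
proof -
  define \<phi> where "\<phi> t = f (x + t *\<^sub>R (y - x))" for t :: real
  have "convex_on UNIV \<phi>"
  proof (rule convex_onI)
    fix t a b :: real
    assume t: "0 < t" "t < 1"
    have "x + ((1 - t) *\<^sub>R a + t *\<^sub>R b) *\<^sub>R (y - x)
        = (1 - t) *\<^sub>R (x + a *\<^sub>R (y - x)) + t *\<^sub>R (x + b *\<^sub>R (y - x))"
      by (simp add: algebra_simps)
    then show "\<phi> ((1 - t) *\<^sub>R a + t *\<^sub>R b) \<le> (1 - t) * \<phi> a + t * \<phi> b"
      unfolding \<phi>_def using convex_onD[OF assms(1)] t by simp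
  qed simp
  moreover have "(\<phi> has_real_derivative inner D (y - x)) (at 0)"
  proof -
    have "((\<lambda>t::real. x + t *\<^sub>R (y - x)) has_derivative (\<lambda>t. t *\<^sub>R (y - x))) (at 0)"
      by (auto intro!: derivative_eq_intros)
    moreover have "(f has_derivative (\<lambda>h. inner h D)) (at (x + 0 *\<^sub>R (y - x)))"
      using assms(2) by (simp add: gderiv_def)
    ultimately have "(\<phi> has_derivative (\<lambda>t. inner (t *\<^sub>R (y - x)) D)) (at 0)"
      unfolding \<phi>_def by (rule has_derivative_compose)
    moreover have "(\<lambda>t. inner (t *\<^sub>R (y - x)) D) = (*) (inner D (y - x))"
      by (simp add: fun_eq_iff inner_commute[of "y - x" D])
    ultimately show ?thesis
      unfolding has_field_derivative_def by simp
  qed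
  ultimately have "\<phi> 1 - \<phi> 0 \<ge> inner D (y - x) * (1 - 0)"
    by (intro convex_on_imp_above_tangent[where A = UNIV]) auto
  then show ?thesis
    by (simp add: \<phi>_def)
qed

lemma Sigma_dict_0: "0 \<le> M \<Longrightarrow> 0 \<in> Sigma_dict 0 M D"
  by (simp add: Sigma_dict_def)

lemma Sigma_dict_Suc:
  assumes "v \<in> Sigma_dict n M D" and "d \<in> D" and "\<bar>s\<bar> * M + \<bar>t\<bar> \<le> M'"
  shows "s *\<^sub>R v + t *\<^sub>R d \<in> Sigma_dict (Suc n) M' D"
proof -
  obtain a e where e: "\<forall>i\<in>{1..n}. e i \<in> D" and a: "(\<Sum>i=1..n. \<bar>a i\<bar>) \<le> M"
    and v: "v = (\<Sum>i=1..n. a i *\<^sub>R e i)"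
    using assms(1) unfolding Sigma_dict_def by blast
  define a' where "a' i = (if i = Suc n then t else s * a i)" for i
  define e' where "e' i = (if i = Suc n then d else e i)" for i
  have "\<forall>i\<in>{1..Suc n}. e' i \<in> D"
    using e assms(2) by (auto simp: e'_def)
  moreover have "(\<Sum>i=1..Suc n. \<bar>a' i\<bar>) \<le> M'"
  proof -
    have "(\<Sum>i=1..Suc n. \<bar>a' i\<bar>) = \<bar>s\<bar> * (\<Sum>i=1..n. \<bar>a i\<bar>) + \<bar>t\<bar>"
      by (simp add: a'_def abs_mult sum_distrib_left)
    also have "\<dots> \<le> \<bar>s\<bar> * M + \<bar>t\<bar>"
      using a by (simp add: mult_left_mono)
    finally show ?thesis
      using assms(3) by linarith
  qed
  moreover have "s *\<^sub>R v + t *\<^sub>R d = (\<Sum>i=1..Suc n. a' i *\<^sub>R e' i)"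
    by (simp add: v a'_def e'_def scaleR_sum_right)
  ultimately show ?thesis
    unfolding Sigma_dict_def by blast
qed

lemma Sigma_dict_norm_le:
  assumes "v \<in> Sigma_dict n M D" and "\<And>d. d \<in> D \<Longrightarrow> norm d \<le> C" and "0 \<le> C"
  shows "norm v \<le> M * C"
proof -
  obtain a e where e: "\<forall>i\<in>{1..n}. e i \<in> D" and a: "(\<Sum>i=1..n. \<bar>a i\<bar>) \<le> M"
    and v: "v = (\<Sum>i=1..n. a i *\<^sub>R e i)"
    using assms(1) unfolding Sigma_dict_def by blast
  have "norm v \<le> (\<Sum>i=1..n. \<bar>a i\<bar> * C)"
    unfolding v using e assms(2) by (intro sum_norm_le) (simp add: mult_left_mono)
  also have "\<dots> = (\<Sum>i=1..n. \<bar>a i\<bar>) * C"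
    by (simp add: sum_distrib_right)
  also have "\<dots> \<le> M * C"
    using a assms(3) by (rule mult_right_mono)
  finally show ?thesis .
qed

lemma Sigma_dict_inner_ge:
  assumes "v \<in> Sigma_dict n M D" and "\<And>d. d \<in> D \<Longrightarrow> \<bar>inner d p\<bar> \<le> m" and "0 \<le> m"
  shows "- (M * m) \<le> inner v p"
proof -
  obtain a e where e: "\<forall>i\<in>{1..n}. e i \<in> D" and a: "(\<Sum>i=1..n. \<bar>a i\<bar>) \<le> M"
    and v: "v = (\<Sum>i=1..n. a i *\<^sub>R e i)"
    using assms(1) unfolding Sigma_dict_def by blast
  have "\<bar>inner v p\<bar> \<le> (\<Sum>i=1..n. \<bar>a i\<bar> * m)"
    unfolding v inner_sum_left real_norm_def[symmetric] using e assms(2)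
    by (intro sum_norm_le) (simp add: abs_mult mult_left_mono)
  also have "\<dots> = (\<Sum>i=1..n. \<bar>a i\<bar>) * m"
    by (simp add: sum_distrib_right)
  also have "\<dots> \<le> M * m"
    using a assms(3) by (rule mult_right_mono)
  finally show ?thesis
    by linarith
qed

lemma B1_inner_ge:
  assumes "b \<in> B1 D" and "\<And>d. d \<in> D \<Longrightarrow> \<bar>inner d p\<bar> \<le> m" and "0 \<le> m"
  shows "- m \<le> inner b p"
proof -
  have "closed {v. - m \<le> inner v p}"
    by (intro closed_Collect_le continuous_intros)
  moreover have "(\<Union>n\<in>{1..}. Sigma_dict n 1 D) \<subseteq> {v. - m \<le> inner v p}"
    using Sigma_dict_inner_ge[of _ _ 1 D p m] assms(2,3) by auto
  ultimately have "B1 D \<subseteq> {v. - m \<le> inner v p}"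
    unfolding B1_def by (intro closure_minimal)
  then show ?thesis
    using assms(1) by auto
qed

text \<open>The infimum in the gauge need not be attained a priori, so \<open>v\<close> is only known to lie in
  \<open>c B\<^sub>1\<close> for \<open>c\<close> arbitrarily close to \<open>M\<close>; the bound survives the limit \<open>c \<rightarrow> M\<close>.\<close>

lemma K1_ball_inner_ge:
  assumes "K1_norm D v \<le> ereal M" and "\<And>d. d \<in> D \<Longrightarrow> \<bar>inner d p\<bar> \<le> m" and "0 \<le> m"
  shows "- (M * m) \<le> inner v p"
proof -
  have approx: "- ((M + \<epsilon>) * m) \<le> inner v p" if "0 < \<epsilon>" for \<epsilon>
  proof -
    have "K1_norm D v < ereal (M + \<epsilon>)"
      using assms(1) that by (simp add: order_le_less_trans)
    then obtain c b where c: "0 < c" "c < M + \<epsilon>" and v: "v = c *\<^sub>R b" and b: "b \<in> B1 D"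
      unfolding K1_norm_def INF_less_iff by auto
    have "- ((M + \<epsilon>) * m) \<le> - (c * m)"
      using c(2) assms(3) by (simp add: mult_right_mono)
    also have "\<dots> = c * - m"
      by simp
    also have "\<dots> \<le> c * inner b p"
      using c(1) B1_inner_ge[OF b assms(2,3)] by (intro mult_left_mono) auto
    finally show ?thesis
      by (simp add: v)
  qed
  have "((\<lambda>\<epsilon>. - ((M + \<epsilon>) * m)) \<longlongrightarrow> - ((M + 0) * m)) (at_right 0)"
    by (intro tendsto_intros)
  then have "- ((M + 0) * m) \<le> inner v p"
  proof (rule tendsto_upperbound)
    show "\<forall>\<^sub>F \<epsilon> in at_right 0. - ((M + \<epsilon>) * m) \<le> inner v p"
      using approx by (simp add: eventually_at_filter)
  qed simp
  then show ?thesis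
    by simp
qed

lemma K1_norm_zero_le:
  assumes "D \<noteq> {}" and "0 < M"
  shows "K1_norm D 0 \<le> ereal M"
proof -
  obtain d where "d \<in> D"
    using assms(1) by blast
  then have "0 \<in> Sigma_dict 1 1 D"
    using Sigma_dict_Suc[OF Sigma_dict_0[of 0 D], of d 0 0 1] by simp
  then have "0 \<in> B1 D"
    unfolding B1_def by (intro subsetD[OF closure_subset]) auto
  then have "0 \<in> (*\<^sub>R) M ` B1 D"
    by (auto intro: image_eqI[of _ _ 0])
  then show ?thesis
    unfolding K1_norm_def using assms(2) by (intro INF_lower) simp
qed

text \<open>The first step size is \<open>1\<close>, so the recursion forgets the initial value \<open>e 0\<close>. From \<open>n\<close> to
  \<open>n + 1\<close>, the contraction factor \<open>(n - 1) / (n + 1)\<close> takes \<open>4 B / n\<close> to \<open>4 B / (n + 1)\<close> less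
  \<open>4 B / (n (n + 1))\<close>, which is at least what the perturbation \<open>4 B / (n + 1)\<^sup>2\<close> adds.\<close>

lemma relaxed_recursion_bound:
  fixes e :: "nat \<Rightarrow> real"
  assumes rec: "\<And>n. n \<ge> 1 \<Longrightarrow>
      e n \<le> (1 - relaxed_step n) * e (n - 1) + B * (relaxed_step n)\<^sup>2"
    and "0 \<le> B" and "n \<ge> 1"
  shows "e n \<le> 4 * B / real n"
  using \<open>n \<ge> 1\<close>
proof (induction n rule: dec_induct)
  case base
  show ?case
    using rec[of 1] \<open>0 \<le> B\<close> by (simp add: relaxed_step_def)
next
  case (step n)
  define x where "x = real n"
  have x: "x \<ge> 1"
    using step.hyps by (simp add: x_def)
  have \<alpha>: "relaxed_step (Suc n) = 2 / (x + 1)"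
    using x by (simp add: relaxed_step_def x_def add.commute min.absorb2)
  have "e (Suc n) \<le> (1 - 2 / (x + 1)) * e n + B * (2 / (x + 1))\<^sup>2"
    using rec[of "Suc n"] by (simp add: \<alpha>)
  also have "\<dots> \<le> (1 - 2 / (x + 1)) * (4 * B / x) + B * (2 / (x + 1))\<^sup>2"
    using step.IH x by (intro add_right_mono mult_left_mono) (auto simp: x_def)
  also have "\<dots> = 4 * B / (x + 1) - 4 * B / (x * (x + 1)\<^sup>2)"
  proof -
    have "x \<noteq> 0" "x + 1 \<noteq> 0"
      using x by auto
    then show ?thesis
      by (simp add: divide_simps) (simp add: power2_eq_square algebra_simps)
  qed
  also have "\<dots> \<le> 4 * B / (x + 1)"
    using x \<open>0 \<le> B\<close> by simp
  finally show ?case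
    by (simp add: x_def add.commute)
qed

lemma relaxed_step_bounds: "0 \<le> relaxed_step n" "relaxed_step n \<le> 1"
  by (simp_all add: relaxed_step_def)

theorem theorem2:
  fixes D :: "'a::{real_inner, complete_space} set"
    and L :: "'a \<Rightarrow> real"
    and C K M :: real
    and u g :: "nat \<Rightarrow> 'a"
  assumes "symmetric_dictionary D"
    and "\<forall>d\<in>D. norm d \<le> C"
    and "convex_on UNIV L"
    and "0 \<le> K" and "K_smooth K L"
    and "0 < M"
    and "relaxed_greedy D L M u g"
  shows "\<forall>n\<ge>1. u n \<in> Sigma_dict n M D \<and>
           L (u n) - (INF v\<in>{v. K1_norm D v \<le> ereal M}. L v) \<le> 32 * (C * M)\<^sup>2 * K / real n"
proof -
  let ?\<alpha> = relaxed_step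
  let ?p = "\<lambda>n. gradient L (u n)"
  have grad: "GDERIV L v :> gradient L v" for v
    using \<open>K_smooth K L\<close> unfolding K_smooth_def by (intro GDERIV_gradient) blast
  have smooth: "L v \<le> L w + inner (gradient L w) (v - w) + K / 2 * (norm (v - w))\<^sup>2" for v w
    using \<open>K_smooth K L\<close> unfolding K_smooth_def by blast
  have u0: "u 0 = 0"
    using \<open>relaxed_greedy D L M u g\<close> unfolding relaxed_greedy_def by blast
  have arg_max: "is_arg_max (\<lambda>h. inner h (?p n)) (\<lambda>h. h \<in> D) (g (Suc n))"
    and u_Suc: "u (Suc n) = (1 - ?\<alpha> (Suc n)) *\<^sub>R u n - (M * ?\<alpha> (Suc n)) *\<^sub>R g (Suc n)" for n
    using \<open>relaxed_greedy D L M u g\<close>[unfolded relaxed_greedy_def, THEN conjunct2, rule_format, of "Suc n"]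
    by simp_all
  have g: "g (Suc n) \<in> D" for n
    using arg_max[of n] by (simp add: is_arg_max_def)
  have g_max: "inner d (?p n) \<le> inner (g (Suc n)) (?p n)" if "d \<in> D" for d n
    using arg_max[of n] that by (simp add: is_arg_max_linorder)
  \<comment> \<open>With \<open>- d\<close> also in the dictionary, the greedy choice maximizes the absolute value of the
    functional.\<close>
  have g_abs_max: "\<bar>inner d (?p n)\<bar> \<le> inner (g (Suc n)) (?p n)" if "d \<in> D" for d n
  proof -
    have "- d \<in> D"
      using that \<open>symmetric_dictionary D\<close> by (simp add: symmetric_dictionary_def)
    then show ?thesis
      using g_max[OF that, of n] g_max[of "- d" n] by simp
  qed
  have norm_D: "norm d \<le> C" if "d \<in> D" for d
    using that assms(2) by blast
  have "0 \<le> C"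
    using norm_D[OF g] norm_ge_zero order_trans by blast

  have u_Sigma: "u n \<in> Sigma_dict n M D" for n
  proof (induction n)
    case 0
    show ?case
      using \<open>0 < M\<close> by (simp add: u0 Sigma_dict_0)
  next
    case (Suc n)
    have "\<bar>1 - ?\<alpha> (Suc n)\<bar> * M + \<bar>- (M * ?\<alpha> (Suc n))\<bar> = M"
      using relaxed_step_bounds[of "Suc n"] \<open>0 < M\<close> by (simp add: abs_mult algebra_simps)
    then show ?case
      using Sigma_dict_Suc[OF Suc g, of "1 - ?\<alpha> (Suc n)" "- (M * ?\<alpha> (Suc n))" M n]
      by (simp add: u_Suc)
  qed
  have diam: "norm (u n + M *\<^sub>R g (Suc n)) \<le> 2 * (C * M)" for n
  proof -
    have "norm (u n) \<le> M * C"
      using u_Sigma norm_D \<open>0 \<le> C\<close> by (rule Sigma_dict_norm_le)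
    moreover have "norm (M *\<^sub>R g (Suc n)) \<le> M * C"
      using norm_D[OF g[of n]] \<open>0 < M\<close> by simp
    ultimately show ?thesis
      using norm_triangle_ineq[of "u n" "M *\<^sub>R g (Suc n)"] by (simp add: mult.commute)
  qed

  have descent: "L (u (Suc n)) - L v
      \<le> (1 - ?\<alpha> (Suc n)) * (L (u n) - L v) + 2 * K * (C * M)\<^sup>2 * (?\<alpha> (Suc n))\<^sup>2"
    if v: "K1_norm D v \<le> ereal M" for n v
  proof -
    define w where "w = u n + M *\<^sub>R g (Suc n)"
    have step: "u (Suc n) - u n = - ?\<alpha> (Suc n) *\<^sub>R w"
      by (simp add: u_Suc w_def algebra_simps)
    have "- inner (?p n) w \<le> L v - L (u n)"
    proof -
      have "0 \<le> inner (g (Suc n)) (?p n)"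
        using g_abs_max[OF g, of n] abs_ge_zero order_trans by blast
      then have "- (M * inner (g (Suc n)) (?p n)) \<le> inner v (?p n)"
        using K1_ball_inner_ge[OF v g_abs_max] by blast
      then have "- inner (?p n) w \<le> inner (?p n) (v - u n)"
        by (simp add: w_def inner_add_right inner_diff_right inner_commute)
      also have "\<dots> \<le> L v - L (u n)"
        using \<open>convex_on UNIV L\<close> grad by (rule convex_on_gradient_le)
      finally show ?thesis .
    qed
    then have linear: "?\<alpha> (Suc n) * (- inner (?p n) w) \<le> ?\<alpha> (Suc n) * (L v - L (u n))"
      using relaxed_step_bounds(1) by (rule mult_left_mono)
    have quadratic: "K / 2 * (norm (u (Suc n) - u n))\<^sup>2 \<le> 2 * K * (C * M)\<^sup>2 * (?\<alpha> (Suc n))\<^sup>2"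
    proof -
      have "(norm w)\<^sup>2 \<le> (2 * (C * M))\<^sup>2"
        unfolding w_def by (intro power_mono diam norm_ge_zero)
      then have "K / 2 * (?\<alpha> (Suc n))\<^sup>2 * (norm w)\<^sup>2 \<le> K / 2 * (?\<alpha> (Suc n))\<^sup>2 * (2 * (C * M))\<^sup>2"
        using \<open>0 \<le> K\<close> by (intro mult_left_mono) auto
      then show ?thesis
        by (simp add: step power_mult_distrib algebra_simps)
    qed
    have "L (u (Suc n)) \<le> L (u n) + ?\<alpha> (Suc n) * (- inner (?p n) w)
        + K / 2 * (norm (u (Suc n) - u n))\<^sup>2"
      using smooth[of "u (Suc n)" "u n"] by (simp add: step)
    also have "\<dots> \<le> L (u n) + ?\<alpha> (Suc n) * (L v - L (u n))
        + 2 * K * (C * M)\<^sup>2 * (?\<alpha> (Suc n))\<^sup>2"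
      using linear quadratic by linarith
    finally show ?thesis
      by (simp add: algebra_simps)
  qed

  have "L (u n) - (INF v\<in>{v. K1_norm D v \<le> ereal M}. L v) \<le> 32 * (C * M)\<^sup>2 * K / real n"
    if "n \<ge> 1" for n
  proof -
    have "L (u n) - 32 * (C * M)\<^sup>2 * K / real n \<le> L v" if v: "K1_norm D v \<le> ereal M" for v
    proof -
      have "L (u k) - L v
          \<le> (1 - ?\<alpha> k) * (L (u (k - 1)) - L v) + 2 * K * (C * M)\<^sup>2 * (?\<alpha> k)\<^sup>2" if "k \<ge> 1" for k
        using descent[OF v, of "k - 1"] that by simp
      then have "L (u n) - L v \<le> 4 * (2 * K * (C * M)\<^sup>2) / real n"
        using \<open>0 \<le> K\<close> \<open>n \<ge> 1\<close>
        by (intro relaxed_recursion_bound[where e = "\<lambda>k. L (u k) - L v"]) auto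
      also have "\<dots> \<le> 32 * (C * M)\<^sup>2 * K / real n"
        using \<open>0 \<le> K\<close> by (intro divide_right_mono) (simp_all add: mult.commute mult_right_mono)
      finally show ?thesis
        by linarith
    qed
    moreover have "{v. K1_norm D v \<le> ereal M} \<noteq> {}"
      using K1_norm_zero_le[of D M] g \<open>0 < M\<close> by blast
    ultimately have "L (u n) - 32 * (C * M)\<^sup>2 * K / real n
        \<le> (INF v\<in>{v. K1_norm D v \<le> ereal M}. L v)"
      by (intro cINF_greatest) auto
    then show ?thesis
      by linarith
  qed
  with u_Sigma show ?thesis
    by blast
qed

end
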